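(* Let $G$ be a Lie group acting smoothly on $\mathbb{R}^n$ and let $f:\mathbb{R}^n\to\mathbb{R}\cup\{\infty\}$ be invariant under this action (i.e. $f(gx)=f(x)$ for all $g\in G$, $x\in\mathbb{R}^n$). If $f$ is Lipschitz continuous near a point $\overline{x}\in\mathrm{int}\,\mathrm{dom} f$, then $$\forall v\in\partial f(y),\quad |P_{T_xGx}(v)|=O(|x-y|\,|v|)$$ for $x\in G\overline{x}$ and $y\in\mathbb{R}^n$ near $\overline{x}$. (That is, there are a constant $c>0$ and a neighborhood $U$ of $\overline{x}$ such that $|P_{T_xGx}(v)|\le c|x-y||v|$ for all $x\in G\overline{x}\cap U$, $y\in U$ and $v\in\partial f(y)$.)
   Context: Smooth means $C^k$ for some fixed $k\in\{1,2,\dots,\infty\}$. $\mathrm{dom} f=\{x:f(x)<\infty\}$ and $\mathrm{int}$ denotes the interior. $f$ is Lipschitz continuous near $\overline{x}$ if there is $L>0$ with $|f(x)-f(y)|\le L|x-y|$ for $x,y\in\mathrm{dom} f$ near $\overline{x}$. $P_V$ is the orthogonal projection onto a subspace $V$ of $\mathbb{R}^n$; $\langle\cdot,\cdot\rangle$ and $|\cdot|$ are the Euclidean inner product and norm. The orbit $Gx=\{gx:g\in G\}$ is an immersed submanifold; with $\theta^{(x)}(g)=gx$ and $e$ the identity of $G$, its tangent space at $x$ is $T_xGx=\mathrm{Im}\,d(\theta^{(x)})_e\subseteq\mathbb{R}^n$. Subdifferential, at a point $\overline{x}$ where $f$ is finite: $\widehat\partial f(\overline{x})=\{v: f(x)\ge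 f(\overline{x})+\langle v,x-\overline{x}\rangle+o(|x-\overline{x}|)\text{ near }\overline{x}\}$; $\partial f(\overline{x})$ is the set of $v$ for which there are $x_k$ and $v_k\in\widehat\partial f(x_k)$ with $(x_k,f(x_k),v_k)\to(\overline{x},f(\overline{x}),v)$.
   Formalization: Smooth is taken as C^k with k in {2,...,∞}; k=1 is excluded because the claim fails there: t.(a,b)=(a+t, b+|a+t|^{3/2}-|a|^{3/2}) with f(a,b)=b-|a|^{3/2} at the origin violates the bound. *)

theory Defs
  imports
    "HOL-Analysis.Analysis"
    "HOL-Algebra.Group_Action"
    "HOL-Library.Landau_Symbols"
begin

section \<open>Maps of class \<open>C\<^sup>k\<close>\<close>

text \<open>
  These two predicates are meant for an open set \<open>S\<close> and a finite-dimensional domain, where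
  continuity of all directional derivatives is the same as continuity of the derivative as a
  map into the linear operators.
\<close>

primrec Cn_on :: "nat \<Rightarrow> 'a::real_normed_vector set \<Rightarrow> ('a \<Rightarrow> 'b::real_normed_vector) \<Rightarrow> bool" where
  "Cn_on 0 S f \<longleftrightarrow> continuous_on S f"
| "Cn_on (Suc n) S f \<longleftrightarrow>
     (\<exists>f'. (\<forall>x\<in>S. (f has_derivative f' x) (at x)) \<and> (\<forall>h. Cn_on n S (\<lambda>x. f' x h)))"

text \<open>The case \<open>k = \<infinity>\<close> gives \<open>C\<^sup>\<infinity>\<close> maps.\<close>

definition Ck_on :: "enat \<Rightarrow> 'a::real_normed_vector set \<Rightarrow> ('a \<Rightarrow> 'b::real_normed_vector) \<Rightarrow> bool" where
  "Ck_on k S f \<longleftrightarrow> (\<forall>n::nat. enat n \<le> k \<longrightarrow> Cn_on n S f)"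


section \<open>Manifolds\<close>

text \<open>
  A chart is a pair of a domain and a map into the model space \<open>'e\<close>. The values of the map
  outside the domain are irrelevant, and its inverse is \<^term>\<open>inv_into U \<phi>\<close>.
\<close>

type_synonym ('g, 'e) atlas = "('g set \<times> ('g \<Rightarrow> 'e)) set"

text \<open>
  The model space is an arbitrary finite-dimensional normed space rather than a Euclidean space
  in the sense of the class \<^class>\<open>euclidean_space\<close>: the latter has positive dimension, and
  \<open>0\<close>-dimensional manifolds (hence discrete Lie groups) would be lost (the one-point type \<open>unit\<close> can be made an instance of the class used here).
  The atlas need not be maximal.
\<close>

definition Ck_manifold :: "enat \<Rightarrow> 'g topology \<Rightarrow> ('g, 'e::real_normed_vector) atlas \<Rightarrow> bool" where
  "Ck_manifold k T A \<longleftrightarrow>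
     (\<exists>B::'e set. finite B \<and> span B = UNIV) \<and>
     Hausdorff_space T \<and> second_countable T \<and>
     (\<forall>(U, \<phi>)\<in>A. openin T U \<and> open (\<phi> ` U) \<and>
        homeomorphic_map (subtopology T U) (top_of_set (\<phi> ` U)) \<phi>) \<and>
     (\<Union>(U, \<phi>)\<in>A. U) = topspace T \<and>
     (\<forall>(U, \<phi>)\<in>A. \<forall>(V, \<psi>)\<in>A. Ck_on k (\<phi> ` (U \<inter> V)) (\<psi> \<circ> inv_into U \<phi>))"

definition prod_atlas :: "('g, 'd) atlas \<Rightarrow> ('h, 'e) atlas \<Rightarrow> ('g \<times> 'h, 'd \<times> 'e) atlas" where
  "prod_atlas A B = {(U \<times> V, map_prod \<phi> \<psi>) | U \<phi> V \<psi>. (U, \<phi>) \<in> A \<and> (V, \<psi>) \<in> B}"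

definition std_atlas :: "('e, 'e) atlas" where
  "std_atlas = {(UNIV, id)}"

definition Ck_map ::
  "enat \<Rightarrow> 'g topology \<Rightarrow> ('g, 'd::real_normed_vector) atlas
    \<Rightarrow> 'h topology \<Rightarrow> ('h, 'e::real_normed_vector) atlas \<Rightarrow> ('g \<Rightarrow> 'h) \<Rightarrow> bool" where
  "Ck_map k T A T' A' F \<longleftrightarrow>
     continuous_map T T' F \<and>
     (\<forall>(U, \<phi>)\<in>A. \<forall>(V, \<psi>)\<in>A'. Ck_on k (\<phi> ` (U \<inter> F -` V)) (\<psi> \<circ> F \<circ> inv_into U \<phi>))"

text \<open>
  The image of the differential at \<open>p\<close> of a map \<open>F\<close> from a manifold with atlas \<open>A\<close> into a normed
  space. In every chart around \<open>p\<close> it is the range of the derivative of the coordinate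
  representation of \<open>F\<close>; by the chain rule, it does not depend on the chart.
\<close>

definition differential_image ::
  "('g, 'e::real_normed_vector) atlas \<Rightarrow> ('g \<Rightarrow> 'b::real_normed_vector) \<Rightarrow> 'g \<Rightarrow> 'b set" where
  "differential_image A F p =
     {D h | U \<phi> D h. (U, \<phi>) \<in> A \<and> p \<in> U \<and> (F \<circ> inv_into U \<phi> has_derivative D) (at (\<phi> p))}"


section \<open>Lie groups and smooth actions\<close>

definition Ck_Lie_group ::
  "enat \<Rightarrow> ('g, 'm) monoid_scheme \<Rightarrow> 'g topology \<Rightarrow> ('g, 'e::real_normed_vector) atlas \<Rightarrow> bool" where
  "Ck_Lie_group k G T A \<longleftrightarrow>
     group G \<and> carrier G = topspace T \<and> Ck_manifold k T A \<and>
     Ck_map k (prod_topology T T) (prod_atlas A A) T A (\<lambda>(g, h). g \<otimes>\<^bsub>G\<^esub> h) \<and>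
     Ck_map k T A T A (\<lambda>g. inv\<^bsub>G\<^esub> g)"

definition Ck_action ::
  "enat \<Rightarrow> ('g, 'm) monoid_scheme \<Rightarrow> 'g topology \<Rightarrow> ('g, 'e::real_normed_vector) atlas
    \<Rightarrow> ('g \<Rightarrow> 'b::real_normed_vector \<Rightarrow> 'b) \<Rightarrow> bool" where
  "Ck_action k G T A \<theta> \<longleftrightarrow>
     group_action G UNIV \<theta> \<and>
     Ck_map k (prod_topology T euclidean) (prod_atlas A std_atlas) euclidean std_atlas
       (\<lambda>(g, x). \<theta> g x)"

definition orbit_tangent ::
  "('g, 'm) monoid_scheme \<Rightarrow> ('g, 'e::real_normed_vector) atlas
    \<Rightarrow> ('g \<Rightarrow> 'b::real_normed_vector \<Rightarrow> 'b) \<Rightarrow> 'b \<Rightarrow> 'b set" where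
  "orbit_tangent G A \<theta> x = differential_image A (\<lambda>g. \<theta> g x) \<one>\<^bsub>G\<^esub>"


section \<open>Variational analysis\<close>

definition orth_proj :: "'b::euclidean_space set \<Rightarrow> 'b \<Rightarrow> 'b" where
  "orth_proj V v = (THE w. w \<in> V \<and> (\<forall>u\<in>V. orthogonal (v - w) u))"

definition edom :: "('b \<Rightarrow> ereal) \<Rightarrow> 'b set" where
  "edom f = {x. f x < \<infinity>}"

definition lipschitz_near :: "('b::real_normed_vector \<Rightarrow> ereal) \<Rightarrow> 'b \<Rightarrow> bool" where
  "lipschitz_near f xb \<longleftrightarrow>
     (\<exists>L>0. \<exists>r>0. \<forall>x \<in> edom f \<inter> ball xb r. \<forall>y \<in> edom f \<inter> ball xb r.
        \<bar>f x - f y\<bar> \<le> ereal (L * norm (x - y)))"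

definition regular_subdiff :: "('b::euclidean_space \<Rightarrow> ereal) \<Rightarrow> 'b \<Rightarrow> 'b set" where
  "regular_subdiff f xb =
     {v. \<bar>f xb\<bar> \<noteq> \<infinity> \<and>
         (\<exists>r::'b \<Rightarrow> real. r \<in> o[nhds xb](\<lambda>x. norm (x - xb)) \<and>
            (\<forall>\<^sub>F x in nhds xb. f x \<ge> f xb + ereal (v \<bullet> (x - xb) + r x)))}"

definition subdiff :: "('b::euclidean_space \<Rightarrow> ereal) \<Rightarrow> 'b \<Rightarrow> 'b set" where
  "subdiff f xb =
     {v. \<bar>f xb\<bar> \<noteq> \<infinity> \<and>
         (\<exists>X V. (\<forall>i::nat. V i \<in> regular_subdiff f (X i)) \<and>
            X \<longlonglongrightarrow> xb \<and> (\<lambda>i. f (X i)) \<longlonglongrightarrow> f xb \<and> V \<longlonglongrightarrow> v)}"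

end

theory Submission
  imports Defs
begin

text \<open>
  Fix a chart around the identity and let \<open>u h x\<close> be the derivative of \<open>g \<mapsto> g x\<close> at the identity
  in the direction \<open>h\<close> of the model space, so that \<open>T\<^sub>x = {u h x | h}\<close> is the tangent space of the
  orbit of \<open>x\<close>.

  Invariance makes \<open>f\<close> constant along the curves in an orbit, so a subgradient \<open>v\<close> at \<open>y\<close> is
  orthogonal to every \<open>u h y\<close> (\<open>subdiff_orthogonal_orbit\<close>). Let \<open>w\<close> be the projection of \<open>v\<close> onto
  \<open>T\<^sub>x\<close>. If \<open>w\<close> is written as \<open>u h x\<close>, then
  \<open>|w|\<^sup>2 = v \<bullet> w = v \<bullet> (u h x - u h y)\<close>, and since the action is of class \<open>C\<^sup>2\<close>, the vector fields
  \<open>u h\<close> are locally Lipschitz: the right-hand side is at most a constant times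
  \<open>|v| |h| |x - y|\<close>. What remains is to choose \<open>h\<close> with \<open>|h|\<close> bounded by a multiple of \<open>|w|\<close>,
  uniformly in \<open>x\<close>.

  This can fail if the rank of \<open>h \<mapsto> u h x\<close> jumps at points arbitrarily close to the base
  point, and it is here that \<open>x\<close> must lie on the given orbit, along which the rank does not grow
  (\<open>orbit_tangent_translate\<close>). Choose directions \<open>h\<^sub>b\<close> such that the vectors \<open>u h\<^sub>b\<close> at the base
  point form an orthonormal basis \<open>b \<in> B\<close> of its tangent space. At nearby points they are still
  independent, so on the orbit, by the bound on the rank, they still span the tangent space;
  and the coefficients of \<open>w\<close> in this basis are bounded by a multiple of \<open>|w|\<close>
  (\<open>sum_coeff_le_near_orthonormal\<close>).
\<close>

section \<open>Maps of class \<open>C\<^sup>k\<close>\<close>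

text \<open>
  The set \<open>S\<close> will be the coordinate image of a preimage; a larger open set on which the maps
  agree saves the proof that it is open.
\<close>

lemma Cn_on_cong:
  assumes "Cn_on n S f" and "S \<subseteq> S'" and "open S'" and "\<And>x. x \<in> S' \<Longrightarrow> f x = g x"
  shows "Cn_on n S g"
proof (cases n)
  case 0
  then show ?thesis
    using assms by (metis Cn_on.simps(1) continuous_on_cong subsetD)
next
  case (Suc m)
  then obtain f' where "\<forall>x\<in>S. (f has_derivative f' x) (at x)" "\<forall>h. Cn_on m S (\<lambda>x. f' x h)"
    using assms(1) by auto
  moreover from this have "\<forall>x\<in>S. (g has_derivative f' x) (at x)"
    using assms by (blast intro: has_derivative_transform_within_open)
  ultimately show ?thesis
    using Suc by auto
qed

lemma Cn_on_slice:
  fixes F :: "'a::real_normed_vector \<times> 'b::real_normed_vector \<Rightarrow> 'c::real_normed_vector"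
  assumes "Cn_on n (S \<times> UNIV) F" and "z \<in> S"
  shows "Cn_on n UNIV (\<lambda>x. F (z, x))"
  using assms
proof (induction n arbitrary: F)
  case 0
  then have "continuous_on (S \<times> UNIV) F"
    by simp
  then have "continuous_on UNIV (\<lambda>x. F (z, x))"
    by (rule continuous_on_compose2) (use 0 in \<open>auto intro!: continuous_intros\<close>)
  then show ?case
    by simp
next
  case (Suc n)
  then obtain F' where F': "\<And>p. p \<in> S \<times> UNIV \<Longrightarrow> (F has_derivative F' p) (at p)"
    and C: "\<And>h. Cn_on n (S \<times> UNIV) (\<lambda>p. F' p h)"
    by auto
  have "((\<lambda>x. F (z, x)) has_derivative (\<lambda>h. F' (z, x) (0, h))) (at x)" for x
  proof -
    have "((\<lambda>x. (z, x)) has_derivative (\<lambda>h. (0, h))) (at x)"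
      by (auto intro!: derivative_eq_intros)
    from diff_chain_at[OF this F'[of "(z, x)"]] show ?thesis
      using Suc.prems by (simp add: o_def)
  qed
  moreover have "Cn_on n UNIV (\<lambda>x. F' (z, x) (0, h))" for h
    using Suc.IH[OF C] Suc.prems by simp
  ultimately show ?case
    unfolding Cn_on.simps by (intro exI[of _ "\<lambda>x h. F' (z, x) (0, h)"]) blast
qed

lemma Cn_on_1_locally_lipschitz:
  fixes u :: "'b::euclidean_space \<Rightarrow> 'c::real_normed_vector"
  assumes "Cn_on (Suc 0) UNIV u"
  obtains L where "L \<ge> 0" and "\<And>x y. x \<in> cball a 1 \<Longrightarrow> y \<in> cball a 1 \<Longrightarrow> norm (u x - u y) \<le> L * norm (x - y)"
proof -
  obtain u' where u': "\<And>x. (u has_derivative u' x) (at x)"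
    and cont: "\<And>h. continuous_on UNIV (\<lambda>x. u' x h)"
    using assms by auto
  have "\<exists>M. \<forall>x\<in>cball a 1. norm (u' x h) \<le> M" for h
  proof -
    have "bounded ((\<lambda>x. u' x h) ` cball a 1)"
      by (intro compact_imp_bounded compact_continuous_image continuous_on_subset[OF cont]) auto
    then show ?thesis
      by (auto simp: bounded_iff)
  qed
  then obtain M where M: "\<And>h x. x \<in> cball a 1 \<Longrightarrow> norm (u' x h) \<le> M h"
    by metis
  define L where "L = (\<Sum>b\<in>Basis. M b)"
  have on: "onorm (u' x) \<le> L" if "x \<in> cball a 1" for x
  proof (rule onorm_le)
    fix h
    have lin: "linear (u' x)"
      using u' has_derivative_linear by blast
    have "norm (u' x h) = norm (\<Sum>b\<in>Basis. (h \<bullet> b) *\<^sub>R u' x b)"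
      by (subst euclidean_representation[symmetric, of h])
        (simp only: linear_sum[OF lin] linear_cmul[OF lin])
    also have "\<dots> \<le> (\<Sum>b\<in>Basis. norm ((h \<bullet> b) *\<^sub>R u' x b))"
      by (rule norm_sum)
    also have "\<dots> \<le> (\<Sum>b\<in>Basis. norm h * M b)"
      by (intro sum_mono) (simp add: mult_mono Basis_le_norm M[OF that])
    finally show "norm (u' x h) \<le> L * norm h"
      by (simp add: L_def sum_distrib_left mult.commute)
  qed
  have "0 \<le> onorm (u' a)"
    by (rule onorm_pos_le) (use u' has_derivative_bounded_linear in blast)
  also have "\<dots> \<le> L"
    by (rule on) simp
  finally have "L \<ge> 0" .
  moreover have "norm (u x - u y) \<le> L * norm (x - y)" if "x \<in> cball a 1" "y \<in> cball a 1" for x y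
    by (rule differentiable_bound[of "cball a 1" u u'])
      (use that on has_derivative_at_withinI[OF u'] in auto)
  ultimately show ?thesis
    by (rule that)
qed


section \<open>Differentiation in charts\<close>

definition chart :: "'g topology \<Rightarrow> 'g set \<Rightarrow> ('g \<Rightarrow> 'e::real_normed_vector) \<Rightarrow> bool" where
  "chart T U \<phi> \<longleftrightarrow> openin T U \<and> open (\<phi> ` U) \<and>
     homeomorphic_map (subtopology T U) (top_of_set (\<phi> ` U)) \<phi>"

lemma chart_inj_on: "chart T U \<phi> \<Longrightarrow> inj_on \<phi> U"
  unfolding chart_def homeomorphic_eq_everything_map
  by (metis openin_subset topspace_subtopology_subset)

lemma chart_open_image:
  assumes "chart T U \<phi>" and "openin T W" and "W \<subseteq> U"
  shows "open (\<phi> ` W)"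
proof -
  have "openin (subtopology T U) W"
    using assms by (simp add: openin_open_subtopology chart_def)
  then have "openin (top_of_set (\<phi> ` U)) (\<phi> ` W)"
    using assms homeomorphic_imp_open_map unfolding chart_def open_map_def by blast
  then show ?thesis
    using assms openin_open_trans unfolding chart_def by blast
qed

lemma chart_UNIV_id: "chart euclidean UNIV id"
  by (simp add: chart_def homeomorphic_map_id)

lemma Ck_manifold_chart: "Ck_manifold k T A \<Longrightarrow> (U, \<phi>) \<in> A \<Longrightarrow> chart T U \<phi>"
  unfolding Ck_manifold_def chart_def by blast

lemma Ck_manifold_chart_at:
  assumes "Ck_manifold k T A" and "p \<in> topspace T"
  obtains U \<phi> where "(U, \<phi>) \<in> A" and "p \<in> U"
  using assms unfolding Ck_manifold_def by blast

text \<open>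
  Continuity of \<open>F\<close> is what keeps nearby points inside the intermediate chart, where going down
  to the model space and back is the identity.
\<close>

lemma chain_rule_in_charts:
  assumes U: "chart T U \<phi>" "p \<in> U" and V: "chart T' V \<psi>" "F p \<in> V"
    and F: "continuous_map T T' F"
    and D: "(\<psi> \<circ> F \<circ> inv_into U \<phi> has_derivative D) (at (\<phi> p))"
    and E: "(H \<circ> inv_into V \<psi> has_derivative E) (at (\<psi> (F p)))"
  shows "((\<lambda>g. H (F g)) \<circ> inv_into U \<phi> has_derivative E \<circ> D) (at (\<phi> p))"
proof -
  define W where "W = U \<inter> {g \<in> topspace T. F g \<in> V}"
  have inj: "inj_on \<phi> U" "inj_on \<psi> V"
    using U V chart_inj_on by auto
  have "openin T W"
    unfolding W_def
    using U V F by (auto simp: chart_def intro!: openin_Int openin_continuous_map_preimage)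
  then have op: "open (\<phi> ` W)"
    by (rule chart_open_image[OF U(1)]) (auto simp: W_def)
  have "p \<in> W"
    using U V unfolding W_def chart_def by (auto dest: openin_subset)
  have "(H \<circ> inv_into V \<psi> has_derivative E) (at ((\<psi> \<circ> F \<circ> inv_into U \<phi>) (\<phi> p)))"
    using E U inj by simp
  from diff_chain_at[OF D this] show ?thesis
  proof (rule has_derivative_transform_within_open[OF _ op])
    show "\<phi> p \<in> \<phi> ` W"
      using \<open>p \<in> W\<close> by blast
    show "(H \<circ> inv_into V \<psi> \<circ> (\<psi> \<circ> F \<circ> inv_into U \<phi>)) z = ((\<lambda>g. H (F g)) \<circ> inv_into U \<phi>) z"
      if "z \<in> \<phi> ` W" for z
      using that inj by (auto simp: W_def)
  qed
qed

lemma inv_into_map_prod: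
  assumes "inj_on \<phi> U" "inj_on \<omega> W" "z \<in> \<phi> ` U" "w \<in> \<omega> ` W"
  shows "inv_into (U \<times> W) (map_prod \<phi> \<omega>) (z, w) = (inv_into U \<phi> z, inv_into W \<omega> w)"
proof (rule inv_into_f_eq)
  show "inj_on (map_prod \<phi> \<omega>) (U \<times> W)"
    using assms by (simp add: map_prod_inj_on)
qed (use assms in \<open>auto simp: inv_into_into f_inv_into_f\<close>)

lemma Ck_map_prod_in_charts:
  assumes F: "Ck_map k (prod_topology T\<^sub>1 T\<^sub>2) (prod_atlas A\<^sub>1 A\<^sub>2) T' A' (\<lambda>(g, h). F g h)"
    and n: "enat n \<le> k"
    and "(U, \<phi>) \<in> A\<^sub>1" "(W, \<omega>) \<in> A\<^sub>2" "(V, \<psi>) \<in> A'"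
    and U: "chart T\<^sub>1 U \<phi>" and W: "chart T\<^sub>2 W \<omega>"
  shows "Cn_on n (map_prod \<phi> \<omega> ` {(g, h) \<in> U \<times> W. F g h \<in> V})
           (\<lambda>(z, w). \<psi> (F (inv_into U \<phi> z) (inv_into W \<omega> w)))"
proof -
  have "(U \<times> W, map_prod \<phi> \<omega>) \<in> prod_atlas A\<^sub>1 A\<^sub>2"
    using assms unfolding prod_atlas_def by blast
  then have "Ck_on k (map_prod \<phi> \<omega> ` ((U \<times> W) \<inter> (\<lambda>(g, h). F g h) -` V))
      (\<psi> \<circ> (\<lambda>(g, h). F g h) \<circ> inv_into (U \<times> W) (map_prod \<phi> \<omega>))"
    using F \<open>(V, \<psi>) \<in> A'\<close> unfolding Ck_map_def by blast
  moreover have "(U \<times> W) \<inter> (\<lambda>(g, h). F g h) -` V = {(g, h) \<in> U \<times> W. F g h \<in> V}"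
    by auto
  ultimately have "Cn_on n (map_prod \<phi> \<omega> ` {(g, h) \<in> U \<times> W. F g h \<in> V})
      (\<psi> \<circ> (\<lambda>(g, h). F g h) \<circ> inv_into (U \<times> W) (map_prod \<phi> \<omega>))"
    using n unfolding Ck_on_def by simp
  then show ?thesis
  proof (rule Cn_on_cong)
    show "open (\<phi> ` U \<times> \<omega> ` W)"
      using U W by (auto simp: chart_def open_Times)
    show "(\<psi> \<circ> (\<lambda>(g, h). F g h) \<circ> inv_into (U \<times> W) (map_prod \<phi> \<omega>)) p =
        (case p of (z, w) \<Rightarrow> \<psi> (F (inv_into U \<phi> z) (inv_into W \<omega> w)))"
      if "p \<in> \<phi> ` U \<times> \<omega> ` W" for p
      using that inv_into_map_prod[OF chart_inj_on[OF U] chart_inj_on[OF W]]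
      by (cases p) (simp del: map_prod_simp)
  qed auto
qed

lemma Ck_map_prod_partial_derivatives:
  assumes F: "Ck_map k (prod_topology T\<^sub>1 T\<^sub>2) (prod_atlas A\<^sub>1 A\<^sub>2) T' A' (\<lambda>(g, h). F g h)"
    and k: "1 \<le> k"
    and mem: "(U, \<phi>) \<in> A\<^sub>1" "(W, \<omega>) \<in> A\<^sub>2" "(V, \<psi>) \<in> A'"
    and U: "chart T\<^sub>1 U \<phi>" and W: "chart T\<^sub>2 W \<omega>"
    and p: "p \<in> U" "q \<in> W" "F p q \<in> V"
  shows "\<exists>D. (\<psi> \<circ> (\<lambda>g. F g q) \<circ> inv_into U \<phi> has_derivative D) (at (\<phi> p))"
    and "\<exists>D. (\<psi> \<circ> (\<lambda>h. F p h) \<circ> inv_into W \<omega> has_derivative D) (at (\<omega> q))"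
proof -
  let ?R = "\<lambda>(z, w). \<psi> (F (inv_into U \<phi> z) (inv_into W \<omega> w))"
  have inv [simp]: "inv_into U \<phi> (\<phi> p) = p" "inv_into W \<omega> (\<omega> q) = q"
    using chart_inj_on[OF U] chart_inj_on[OF W] p by auto
  have "Cn_on (Suc 0) (map_prod \<phi> \<omega> ` {(g, h) \<in> U \<times> W. F g h \<in> V}) ?R"
    using k by (intro Ck_map_prod_in_charts[OF F _ mem U W]) (simp add: one_enat_def)
  then obtain R' where
    R': "\<forall>q\<in>map_prod \<phi> \<omega> ` {(g, h) \<in> U \<times> W. F g h \<in> V}. (?R has_derivative R' q) (at q)"
    unfolding Cn_on.simps by (elim exE conjE)
  have "(\<phi> p, \<omega> q) \<in> map_prod \<phi> \<omega> ` {(g, h) \<in> U \<times> W. F g h \<in> V}"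
    using p by force
  with R' have D: "(?R has_derivative R' (\<phi> p, \<omega> q)) (at (\<phi> p, \<omega> q))"
    by (rule bspec)
  have "((\<lambda>z. (z, \<omega> q)) has_derivative (\<lambda>h. (h, 0))) (at (\<phi> p))"
    by (auto intro!: derivative_eq_intros)
  from diff_chain_at[OF this D]
  show "\<exists>D. (\<psi> \<circ> (\<lambda>g. F g q) \<circ> inv_into U \<phi> has_derivative D) (at (\<phi> p))"
    by (auto simp: o_def)
  have "((\<lambda>w. (\<phi> p, w)) has_derivative (\<lambda>h. (0, h))) (at (\<omega> q))"
    by (auto intro!: derivative_eq_intros)
  from diff_chain_at[OF this D]
  show "\<exists>D. (\<psi> \<circ> (\<lambda>h. F p h) \<circ> inv_into W \<omega> has_derivative D) (at (\<omega> q))"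
    by (auto simp: o_def)
qed


section \<open>Tangent spaces of orbits\<close>

text \<open>
  In a fixed chart, the derivative at \<open>p\<close> of the orbit map \<open>g \<mapsto> g x\<close> is a family \<open>u h x\<close>, where
  the direction \<open>h\<close> lives in the model space. The action being of class \<open>C\<^sup>2\<close> jointly in
  \<open>g\<close> and \<open>x\<close>, these vector fields on the space acted upon are still of class \<open>C\<^sup>1\<close>.
\<close>

lemma orbit_map_derivative:
  fixes \<theta> :: "'g \<Rightarrow> 'b::real_normed_vector \<Rightarrow> 'b"
  assumes act: "Ck_action k G T A \<theta>" and k: "2 \<le> k"
    and U: "(U, \<phi>) \<in> A" "chart T U \<phi>" "p \<in> U"
  obtains u where
    "\<And>x. ((\<lambda>g. \<theta> g x) \<circ> inv_into U \<phi> has_derivative (\<lambda>h. u h x)) (at (\<phi> p))"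
    and "\<And>h. Cn_on (Suc 0) UNIV (u h)"
proof -
  let ?F = "\<lambda>(z, x). \<theta> (inv_into U \<phi> z) x"
  have "Cn_on 2 (map_prod \<phi> id ` {(g, x) \<in> U \<times> UNIV. \<theta> g x \<in> UNIV})
      (\<lambda>(z, x). id (\<theta> (inv_into U \<phi> z) (inv_into UNIV id x)))"
    using act k U
    by (intro Ck_map_prod_in_charts[where k = k and A\<^sub>1 = A and A\<^sub>2 = std_atlas and A' = std_atlas
          and T\<^sub>1 = T and T\<^sub>2 = euclidean and T' = euclidean] chart_UNIV_id)
      (auto simp: Ck_action_def std_atlas_def numeral_eq_enat)
  moreover have "map_prod \<phi> id ` {(g, x) \<in> U \<times> UNIV. \<theta> g x \<in> UNIV} = \<phi> ` U \<times> UNIV"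
    by force
  ultimately have "Cn_on (Suc (Suc 0)) (\<phi> ` U \<times> UNIV) ?F"
    unfolding numeral_2_eq_2 by (simp only: inv_id id_apply)
  then obtain F' where F': "\<And>q. q \<in> \<phi> ` U \<times> UNIV \<Longrightarrow> (?F has_derivative F' q) (at q)"
    and C: "\<And>h. Cn_on (Suc 0) (\<phi> ` U \<times> UNIV) (\<lambda>q. F' q h)"
    by (subst (asm) Cn_on.simps(2)) blast
  show ?thesis
  proof (rule that[of "\<lambda>h x. F' (\<phi> p, x) (h, 0)"])
    fix x :: 'b
    have "((\<lambda>z. (z, x)) has_derivative (\<lambda>h. (h, 0))) (at (\<phi> p))"
      by (auto intro!: derivative_eq_intros)
    from diff_chain_at[OF this F'[of "(\<phi> p, x)"]]
    show "((\<lambda>g. \<theta> g x) \<circ> inv_into U \<phi> has_derivative (\<lambda>h. F' (\<phi> p, x) (h, 0))) (at (\<phi> p))"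
      using U by (simp add: o_def)
  next
    fix h
    show "Cn_on (Suc 0) UNIV (\<lambda>x. F' (\<phi> p, x) (h, 0))"
      by (rule Cn_on_slice[OF C]) (use U in auto)
  qed
qed

lemma action_differentiable:
  assumes act: "Ck_action k G T A \<theta>" and k: "1 \<le> k" and man: "Ck_manifold k T A"
    and g: "g \<in> topspace T"
  shows "\<exists>D. (\<theta> g has_derivative D) (at x)"
proof -
  obtain W \<omega> where W: "(W, \<omega>) \<in> A" "g \<in> W"
    using Ck_manifold_chart_at[OF man g] .
  have "\<exists>D. (id \<circ> (\<lambda>x. \<theta> g x) \<circ> inv_into UNIV id has_derivative D) (at (id x))"
    using act k W Ck_manifold_chart[OF man]
    by (intro Ck_map_prod_partial_derivatives(2)[where k = k and A\<^sub>1 = A and A\<^sub>2 = std_atlas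
          and A' = std_atlas and T\<^sub>1 = T and T\<^sub>2 = euclidean and T' = euclidean and V = UNIV and U = W]
        chart_UNIV_id)
      (auto simp: Ck_action_def std_atlas_def)
  then show ?thesis
    by (simp add: o_def)
qed

text \<open>
  Since \<open>h (g x) = g ((g\<inverse> h g) x)\<close>, the orbit map at \<open>g x\<close> is the orbit map at \<open>x\<close>, preceded by a
  conjugation, which fixes the identity, and followed by the action of \<open>g\<close>. By the
  chain rule the differential of \<open>g\<close> carries the tangent space at \<open>x\<close> onto a space that contains
  the one at \<open>g x\<close>; hence the dimension cannot grow along an orbit. The charts used at the
  two points need not be the same, so this also removes the dependence on the chart.
\<close>

lemma orbit_tangent_translate:
  fixes G :: "('g, 'm) monoid_scheme" (structure)
  assumes Lie: "Ck_Lie_group k G T A" and act: "Ck_action k G T A \<theta>" and k: "1 \<le> k"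
    and U: "(U, \<phi>) \<in> A" "\<one>\<^bsub>G\<^esub> \<in> U"
    and E: "((\<lambda>g. \<theta> g x) \<circ> inv_into U \<phi> has_derivative E) (at (\<phi> \<one>\<^bsub>G\<^esub>))"
    and g: "g \<in> carrier G"
  obtains \<Theta> where "linear \<Theta>" and "orbit_tangent G A \<theta> (\<theta> g x) \<subseteq> \<Theta> ` range E"
proof -
  interpret group G
    using Lie by (simp add: Ck_Lie_group_def)
  interpret group_action G UNIV \<theta>
    using act by (simp add: Ck_action_def)
  have man: "Ck_manifold k T A" and car: "carrier G = topspace T"
    and mult: "Ck_map k (prod_topology T T) (prod_atlas A A) T A (\<lambda>(g, h). g \<otimes> h)"
    using Lie by (auto simp: Ck_Lie_group_def)
  note ch = Ck_manifold_chart[OF man]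
  have contm: "continuous_map (prod_topology T T) T (\<lambda>(g, h). g \<otimes> h)"
    using mult by (simp add: Ck_map_def)
  have contR: "continuous_map T T (\<lambda>h. h \<otimes> g)" and contL: "continuous_map T T (\<lambda>h. inv g \<otimes> h)"
    using continuous_map_compose[OF _ contm, of T "\<lambda>h. (h, g)"]
      continuous_map_compose[OF _ contm, of T "\<lambda>h. (inv g, h)"] g car
    by (auto simp: o_def continuous_map_paired inv_closed[OF g, unfolded car])
  obtain W \<omega> where W: "(W, \<omega>) \<in> A" "g \<in> W"
    using Ck_manifold_chart_at[OF man] g car by metis
  obtain W' \<omega>' where W': "(W', \<omega>') \<in> A" "inv g \<in> W'"
    using Ck_manifold_chart_at[OF man] inv_closed[OF g] car by metis
  obtain \<Theta> where \<Theta>: "(\<theta> g has_derivative \<Theta>) (at x)"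
    using action_differentiable[OF act k man] g car by blast
  have one: "\<theta> \<one> x = x"
    using id_eq_one by (metis UNIV_I restrict_apply')
  show ?thesis
  proof (rule that[of \<Theta>])
    show "linear \<Theta>"
      using \<Theta> has_derivative_linear by blast
    show "orbit_tangent G A \<theta> (\<theta> g x) \<subseteq> \<Theta> ` range E"
    proof
      fix w assume "w \<in> orbit_tangent G A \<theta> (\<theta> g x)"
      then obtain U' \<phi>' D h where U': "(U', \<phi>') \<in> A" "\<one> \<in> U'" and w: "w = D h"
        and D: "((\<lambda>h. \<theta> h (\<theta> g x)) \<circ> inv_into U' \<phi>' has_derivative D) (at (\<phi>' \<one>))"
        unfolding orbit_tangent_def differential_image_def by blast
      obtain DR where DR: "(\<omega> \<circ> (\<lambda>h. h \<otimes> g) \<circ> inv_into U' \<phi>' has_derivative DR) (at (\<phi>' \<one>))"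
        using Ck_map_prod_partial_derivatives(1)[OF mult k U'(1) W(1) W(1) ch ch U'(2) W(2)] g W U'
        by auto
      obtain DL where DL: "(\<phi> \<circ> (\<lambda>h. inv g \<otimes> h) \<circ> inv_into W \<omega> has_derivative DL) (at (\<omega> g))"
        using Ck_map_prod_partial_derivatives(2)[OF mult k W'(1) W(1) U(1) ch ch W'(2) W(2)] g W U W'
        by auto
      have "((\<lambda>h. \<theta> (inv g \<otimes> h) x) \<circ> inv_into W \<omega> has_derivative E \<circ> DL) (at (\<omega> g))"
        by (rule chain_rule_in_charts[OF ch[OF W(1)] W(2) ch[OF U(1)] _ contL DL])
          (use U g E in auto)
      then have "((\<lambda>h. \<theta> (inv g \<otimes> (h \<otimes> g)) x) \<circ> inv_into U' \<phi>' has_derivative E \<circ> DL \<circ> DR)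
          (at (\<phi>' \<one>))"
        by (intro chain_rule_in_charts[where E = "E \<circ> DL", OF ch[OF U'(1)] U'(2) ch[OF W(1)] _ contR DR])
          (use W g in auto)
      moreover have "inv_into U' \<phi>' (\<phi>' \<one>) = \<one>"
        using chart_inj_on[OF ch[OF U'(1)]] U' by simp
      then have "(\<theta> g has_derivative \<Theta>)
          (at (((\<lambda>h. \<theta> (inv g \<otimes> (h \<otimes> g)) x) \<circ> inv_into U' \<phi>') (\<phi>' \<one>)))"
        using \<Theta> one g by simp
      ultimately have "(\<theta> g \<circ> ((\<lambda>h. \<theta> (inv g \<otimes> (h \<otimes> g)) x) \<circ> inv_into U' \<phi>')
          has_derivative \<Theta> \<circ> (E \<circ> DL \<circ> DR)) (at (\<phi>' \<one>))"
        by (rule diff_chain_at)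
      then have "((\<lambda>h. \<theta> h (\<theta> g x)) \<circ> inv_into U' \<phi>' has_derivative \<Theta> \<circ> (E \<circ> DL \<circ> DR)) (at (\<phi>' \<one>))"
      proof (rule has_derivative_transform_within_open)
        show "open (\<phi>' ` U')"
          using ch[OF U'(1)] by (simp add: chart_def)
        show "\<phi>' \<one> \<in> \<phi>' ` U'"
          using U' by blast
        fix z assume z: "z \<in> \<phi>' ` U'"
        have "U' \<subseteq> carrier G"
          using ch[OF U'(1)] car by (auto simp: chart_def dest: openin_subset)
        then have h: "inv_into U' \<phi>' z \<in> carrier G" (is "?h \<in> _")
          using inv_into_into[OF z] by (rule subsetD)
        have "\<theta> g (\<theta> (inv g \<otimes> (?h \<otimes> g)) x) = \<theta> (g \<otimes> (inv g \<otimes> (?h \<otimes> g))) x"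
          using h g by (intro composition_rule[symmetric]) auto
        also have "g \<otimes> (inv g \<otimes> (?h \<otimes> g)) = ?h \<otimes> g"
          using h g by (simp add: m_assoc[symmetric])
        also have "\<theta> (?h \<otimes> g) x = \<theta> ?h (\<theta> g x)"
          using h g by (intro composition_rule) auto
        finally show "(\<theta> g \<circ> ((\<lambda>h. \<theta> (inv g \<otimes> (h \<otimes> g)) x) \<circ> inv_into U' \<phi>')) z =
            ((\<lambda>h. \<theta> h (\<theta> g x)) \<circ> inv_into U' \<phi>') z"
          by simp
      qed
      then have "D = \<Theta> \<circ> (E \<circ> DL \<circ> DR)"
        by (rule has_derivative_unique[OF D])
      then show "w \<in> \<Theta> ` range E"
        using w by auto
    qed
  qed
qed


section \<open>Subgradients of invariant functions\<close>

text \<open>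
  Along a curve on which \<open>f\<close> is constant, the minorant of \<open>f - f y\<close> provided by a regular
  subgradient is nonpositive and vanishes at the base point, so its derivative there is zero.
\<close>

lemma regular_subdiff_orthogonal_level_curve:
  fixes \<gamma> :: "real \<Rightarrow> 'b::euclidean_space"
  assumes v: "v \<in> regular_subdiff f y"
    and \<gamma>: "(\<gamma> has_derivative (\<lambda>t. t *\<^sub>R w)) (at 0)" "\<gamma> 0 = y"
    and level: "\<forall>\<^sub>F t in nhds 0. f (\<gamma> t) = f y"
  shows "v \<bullet> w = 0"
proof -
  obtain r where fin: "\<bar>f y\<bar> \<noteq> \<infinity>" and r: "r \<in> o[nhds y](\<lambda>x. norm (x - y))"
    and ev: "\<forall>\<^sub>F x in nhds y. f x \<ge> f y + ereal (v \<bullet> (x - y) + r x)"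
    using v unfolding regular_subdiff_def by auto
  have small: "\<forall>\<^sub>F x in nhds y. norm (r x) \<le> c * norm (x - y)" if "c > 0" for c
    using landau_o.smallD[OF r that] by simp
  have r0: "r y = 0"
    using eventually_nhds_x_imp_x[OF small[of 1]] by simp
  have "(r has_derivative (\<lambda>_. 0)) (at y)"
    unfolding has_derivative_within_alt2
  proof (intro conjI allI impI)
    fix e :: real assume "e > 0"
    from small[OF this] have "\<forall>\<^sub>F x in at y. norm (r x) \<le> e * norm (x - y)"
      by (simp add: eventually_nhds_conv_at)
    then show "\<forall>\<^sub>F x in at y. norm (r x - r y - 0) \<le> e * norm (x - y)"
      using r0 by simp
  qed simp
  then have "((\<lambda>x. v \<bullet> (x - y) + r x) has_derivative (\<lambda>h. v \<bullet> h)) (at (\<gamma> 0))"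
    using \<gamma>(2) by (auto intro!: derivative_eq_intros)
  from diff_chain_at[OF \<gamma>(1) this]
  have "((\<lambda>t. v \<bullet> (\<gamma> t - y) + r (\<gamma> t)) has_derivative (\<lambda>t. t *\<^sub>R (v \<bullet> w))) (at 0)"
    by (simp add: o_def)
  then have d: "((\<lambda>t. v \<bullet> (\<gamma> t - y) + r (\<gamma> t)) has_real_derivative (v \<bullet> w)) (at 0)"
    unfolding has_field_derivative_def
    by (rule has_derivative_eq_rhs) (simp add: fun_eq_iff mult.commute)
  have "(\<gamma> \<longlongrightarrow> \<gamma> 0) (nhds 0)"
    using has_derivative_continuous[OF \<gamma>(1)] by (simp add: isCont_def tendsto_at_iff_tendsto_nhds)
  then have "\<forall>\<^sub>F t in nhds 0. f (\<gamma> t) \<ge> f y + ereal (v \<bullet> (\<gamma> t - y) + r (\<gamma> t))"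
    using eventually_compose_filterlim[OF ev] \<gamma>(2) by simp
  with level have "\<forall>\<^sub>F t in nhds 0. v \<bullet> (\<gamma> t - y) + r (\<gamma> t) \<le> 0"
  proof eventually_elim
    case (elim t)
    then show ?case
      using fin by (cases "f y") auto
  qed
  then obtain d where "d > 0" "\<And>t. dist t 0 < d \<Longrightarrow> v \<bullet> (\<gamma> t - y) + r (\<gamma> t) \<le> 0"
    by (auto simp: eventually_nhds_metric)
  then show ?thesis
    using \<gamma>(2) r0 by (intro DERIV_local_max[OF d, of d]) (auto simp: dist_real_def)
qed

text \<open>
  The direction \<open>h\<close> is a vector of the model space, independent of the base point. This is what
  allows the limit in the definition of the subdifferential to be taken in \<open>v \<bullet> u h y = 0\<close>.
\<close>

lemma subdiff_orthogonal_orbit: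
  fixes f :: "'b::euclidean_space \<Rightarrow> ereal"
  assumes act: "Ck_action k G T A \<theta>" and car: "carrier G = topspace T"
    and inv: "\<forall>g\<in>carrier G. \<forall>x. f (\<theta> g x) = f x"
    and U: "chart T U \<phi>" "\<one>\<^bsub>G\<^esub> \<in> U"
    and u: "\<And>x. ((\<lambda>g. \<theta> g x) \<circ> inv_into U \<phi> has_derivative (\<lambda>h. u h x)) (at (\<phi> \<one>\<^bsub>G\<^esub>))"
    and cont: "continuous_on UNIV (u h)"
    and v: "v \<in> subdiff f y"
  shows "v \<bullet> u h y = 0"
proof -
  interpret group_action G UNIV \<theta>
    using act by (simp add: Ck_action_def)
  have reg: "v \<bullet> u h y = 0" if v: "v \<in> regular_subdiff f y" for v y
  proof (rule regular_subdiff_orthogonal_level_curve[OF v])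
    let ?\<gamma> = "\<lambda>t::real. \<theta> (inv_into U \<phi> (\<phi> \<one>\<^bsub>G\<^esub> + t *\<^sub>R h)) y"
    have line: "((\<lambda>t. \<phi> \<one>\<^bsub>G\<^esub> + t *\<^sub>R h) has_derivative (\<lambda>t. t *\<^sub>R h)) (at 0)"
      by (auto intro!: derivative_eq_intros)
    have "linear (\<lambda>h. u h y)"
      using u has_derivative_linear by blast
    have "((\<lambda>g. \<theta> g y) \<circ> inv_into U \<phi> has_derivative (\<lambda>h. u h y)) (at (\<phi> \<one>\<^bsub>G\<^esub> + 0 *\<^sub>R h))"
      using u[of y] by simp
    from diff_chain_at[OF line this] have "(?\<gamma> has_derivative (\<lambda>t. u (t *\<^sub>R h) y)) (at 0)"
      by (simp add: o_def)
    with \<open>linear (\<lambda>h. u h y)\<close> show "(?\<gamma> has_derivative (\<lambda>t. t *\<^sub>R u h y)) (at 0)"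
      by (simp add: linear_cmul[OF \<open>linear (\<lambda>h. u h y)\<close>])
    show "?\<gamma> 0 = y"
      using U chart_inj_on[OF U(1)] id_eq_one by (simp add: restrict_def) (metis)
    have "open (\<phi> ` U)" "\<phi> \<one>\<^bsub>G\<^esub> \<in> \<phi> ` U"
      using U by (auto simp: chart_def)
    moreover have "((\<lambda>t::real. \<phi> \<one>\<^bsub>G\<^esub> + t *\<^sub>R h) \<longlongrightarrow> \<phi> \<one>\<^bsub>G\<^esub> + 0 *\<^sub>R h) (nhds 0)"
      by (intro tendsto_intros filterlim_ident)
    ultimately have "\<forall>\<^sub>F t::real in nhds 0. \<phi> \<one>\<^bsub>G\<^esub> + t *\<^sub>R h \<in> \<phi> ` U"
      by (auto simp: tendsto_def)
    then show "\<forall>\<^sub>F t in nhds 0. f (?\<gamma> t) = f y"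
    proof eventually_elim
      case (elim t)
      have "U \<subseteq> carrier G"
        using U car by (auto simp: chart_def dest: openin_subset)
      then have "inv_into U \<phi> (\<phi> \<one>\<^bsub>G\<^esub> + t *\<^sub>R h) \<in> carrier G"
        using inv_into_into[OF elim] by blast
      then show ?case
        using inv by blast
    qed
  qed
  obtain X V where X: "\<And>i. V i \<in> regular_subdiff f (X i)" "X \<longlonglongrightarrow> y" and V: "V \<longlonglongrightarrow> v"
    using v unfolding subdiff_def by blast
  have "(\<lambda>i. u h (X i)) \<longlonglongrightarrow> u h y"
    using continuous_on_tendsto_compose[OF cont X(2)] by simp
  then have "(\<lambda>i. V i \<bullet> u h (X i)) \<longlonglongrightarrow> v \<bullet> u h y"
    by (intro tendsto_inner V)
  then show ?thesis
    using reg[OF X(1)] by (simp add: LIMSEQ_const_iff)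
qed


section \<open>Bases of nearby subspaces\<close>

text \<open>
  Near an orthonormal system, linear combinations still control their coefficients, with a
  constant that depends on the number of vectors only: each coefficient is the inner product of
  the unperturbed combination with a unit vector, and after summation over the system the
  perturbation costs at most half of the sum of all \<open>\<bar>a b\<bar>\<close>.
\<close>

lemma sum_coeff_le_near_orthonormal:
  fixes B :: "'b::euclidean_space set" and u :: "'b \<Rightarrow> 'b"
  assumes fin: "finite B" and orth: "pairwise orthogonal B" and unit: "\<And>b. b \<in> B \<Longrightarrow> norm b = 1"
    and near: "\<And>b. b \<in> B \<Longrightarrow> norm (u b - b) \<le> e" and e: "real (card B) * e \<le> 1 / 2"
  shows "(\<Sum>b\<in>B. \<bar>a b\<bar>) \<le> 2 * real (card B) * norm (\<Sum>b\<in>B. a b *\<^sub>R u b)"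
proof -
  define w where "w = (\<Sum>b\<in>B. a b *\<^sub>R u b)"
  define S where "S = (\<Sum>b\<in>B. \<bar>a b\<bar>)"
  have "\<bar>a b\<bar> \<le> norm w + e * S" if b: "b \<in> B" for b
  proof -
    have "(\<Sum>c\<in>B. a c *\<^sub>R c) \<bullet> b = (\<Sum>c\<in>B. if c = b then a b else 0)"
      unfolding inner_sum_left
    proof (rule sum.cong[OF refl])
      fix c assume "c \<in> B"
      then show "a c *\<^sub>R c \<bullet> b = (if c = b then a b else 0)"
        using b orth unit[OF b] by (auto simp: pairwise_def orthogonal_def dot_square_norm)
    qed
    then have "a b = (\<Sum>c\<in>B. a c *\<^sub>R c) \<bullet> b"
      using fin b by simp
    then have "\<bar>a b\<bar> \<le> norm (\<Sum>c\<in>B. a c *\<^sub>R c)"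
      using Cauchy_Schwarz_ineq2[of "\<Sum>c\<in>B. a c *\<^sub>R c" b] unit[OF b] by simp
    also have "(\<Sum>c\<in>B. a c *\<^sub>R c) = w - (\<Sum>c\<in>B. a c *\<^sub>R (u c - c))"
      by (simp add: w_def scaleR_diff_right sum_subtractf)
    also have "norm \<dots> \<le> norm w + norm (\<Sum>c\<in>B. a c *\<^sub>R (u c - c))"
      by (rule norm_triangle_ineq4)
    also have "norm (\<Sum>c\<in>B. a c *\<^sub>R (u c - c)) \<le> (\<Sum>c\<in>B. \<bar>a c\<bar> * e)"
      by (rule sum_norm_le) (simp add: near mult_left_mono)
    finally show ?thesis
      by (simp add: S_def sum_distrib_left mult.commute[of _ e])
  qed
  then have "S \<le> (\<Sum>b\<in>B. norm w + e * S)"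
    unfolding S_def by (rule sum_mono)
  also have "\<dots> = real (card B) * norm w + (real (card B) * e) * S"
    by (simp add: algebra_simps)
  also have "(real (card B) * e) * S \<le> 1 / 2 * S"
    by (rule mult_right_mono[OF e]) (simp add: S_def sum_nonneg)
  finally show ?thesis
    by (simp add: S_def w_def)
qed

lemma near_orthonormal_inj_independent:
  fixes B :: "'b::euclidean_space set" and u :: "'b \<Rightarrow> 'b"
  assumes "finite B" "pairwise orthogonal B" "\<And>b. b \<in> B \<Longrightarrow> norm b = 1"
    "\<And>b. b \<in> B \<Longrightarrow> norm (u b - b) \<le> e" "real (card B) * e \<le> 1 / 2"
  shows "inj_on u B" and "independent (u ` B)"
proof -
  note coeff = sum_coeff_le_near_orthonormal[OF assms]
  have zero: "a b = 0" if "(\<Sum>b\<in>B. a b *\<^sub>R u b) = 0" "b \<in> B" for a :: "'b \<Rightarrow> real" and b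
  proof -
    have "\<bar>a b\<bar> \<le> (\<Sum>b\<in>B. \<bar>a b\<bar>)"
      using assms(1) that by (intro member_le_sum) auto
    then show ?thesis
      using coeff[of a] that by simp
  qed
  show inj: "inj_on u B"
  proof (rule inj_onI, rule ccontr)
    fix b c assume bc: "b \<in> B" "c \<in> B" "u b = u c" "b \<noteq> c"
    let ?a = "\<lambda>d. (if d = b then 1 else 0) - (if d = c then 1 else 0) :: real"
    have "(\<Sum>d\<in>B. ?a d *\<^sub>R u d) = 0"
      using bc assms(1) by (simp add: scaleR_diff_left sum_subtractf if_distrib[of "\<lambda>t. t *\<^sub>R _"] cong: if_cong)
    from zero[OF this bc(1)] bc show False
      by simp
  qed
  show "independent (u ` B)"
  proof (rule independent_if_scalars_zero)
    show "finite (u ` B)"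
      using assms(1) by simp
    fix a x assume "(\<Sum>x\<in>u ` B. a x *\<^sub>R x) = 0" and x: "x \<in> u ` B"
    then have "(\<Sum>b\<in>B. a (u b) *\<^sub>R u b) = 0"
      by (simp add: sum.reindex[OF inj] o_def)
    from zero[OF this] x show "a x = 0"
      by auto
  qed
qed

text \<open>
  The set \<open>V\<close> is going to be a tangent space, which collects the derivatives in all charts and is
  therefore not a subspace by its definition.
\<close>

lemma span_eq_if_dim_le:
  fixes S V :: "'b::euclidean_space set"
  assumes "span S \<subseteq> V" and "V \<subseteq> W" and "subspace W" and "independent S" and "dim W \<le> card S"
  shows "V = span S"
proof -
  have "span S = W"
    using assms by (intro subspace_dim_equal) (auto simp: dim_eq_card_independent)
  then show ?thesis
    using assms by blast
qed

lemma orth_proj_span: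
  fixes v :: "'b::euclidean_space"
  shows "orth_proj (span S) v \<in> span S"
    and "u \<in> span S \<Longrightarrow> orthogonal (v - orth_proj (span S) v) u"
proof -
  obtain w z where wz: "w \<in> span S" "\<And>u. u \<in> span S \<Longrightarrow> orthogonal z u" "v = w + z"
    using orthogonal_subspace_decomp_exists[of S v] by blast
  have "orth_proj (span S) v = w"
    unfolding orth_proj_def
  proof (rule the_equality)
    show "w \<in> span S \<and> (\<forall>u\<in>span S. orthogonal (v - w) u)"
      using wz by simp
    fix w' assume w': "w' \<in> span S \<and> (\<forall>u\<in>span S. orthogonal (v - w') u)"
    then have "w - w' \<in> span S"
      using wz span_diff by blast
    then have "orthogonal (v - w') (w - w')" "orthogonal (v - w) (w - w')"
      using w' wz by auto
    then have "(w - w') \<bullet> (w - w') = 0"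
      by (simp add: orthogonal_def inner_diff_left)
    then show "w' = w"
      by simp
  qed
  then show "orth_proj (span S) v \<in> span S"
    and "u \<in> span S \<Longrightarrow> orthogonal (v - orth_proj (span S) v) u"
    using wz by auto
qed


section \<open>The estimate\<close>

theorem proposition4:
  fixes G :: "('g, 'm) monoid_scheme"
    and T :: "'g topology"
    and A :: "('g, 'e::real_normed_vector) atlas"
    and \<theta> :: "'g \<Rightarrow> real ^ 'n \<Rightarrow> real ^ 'n"
    and f :: "real ^ 'n \<Rightarrow> ereal"
    and xb :: "real ^ 'n"
    and k :: enat
  assumes "2 \<le> k"
    and "Ck_Lie_group k G T A"
    and "Ck_action k G T A \<theta>"
    and "\<forall>x. f x \<noteq> -\<infinity>"
    and "\<forall>g\<in>carrier G. \<forall>x. f (\<theta> g x) = f x"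
    and "xb \<in> interior (edom f)"
    and "lipschitz_near f xb"
  shows "\<exists>c>0. \<exists>U. open U \<and> xb \<in> U \<and>
           (\<forall>x \<in> orbit G \<theta> xb \<inter> U. \<forall>y \<in> U. \<forall>v \<in> subdiff f y.
              norm (orth_proj (orbit_tangent G A \<theta> x) v) \<le> c * norm (x - y) * norm v)"
proof -
  interpret group G
    using assms(2) by (simp add: Ck_Lie_group_def)
  have man: "Ck_manifold k T A" and car: "carrier G = topspace T"
    using assms(2) by (auto simp: Ck_Lie_group_def)
  have k1: "1 \<le> k"
    using assms(1) by (rule order_trans[rotated]) simp
  obtain U0 \<phi> where U0: "(U0, \<phi>) \<in> A" "\<one>\<^bsub>G\<^esub> \<in> U0"
    using Ck_manifold_chart_at[OF man] car one_closed by metis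
  note ch = Ck_manifold_chart[OF man U0(1)]
  obtain u where
    u: "\<And>x. ((\<lambda>g. \<theta> g x) \<circ> inv_into U0 \<phi> has_derivative (\<lambda>h. u h x)) (at (\<phi> \<one>\<^bsub>G\<^esub>))"
    and C1: "\<And>h. Cn_on (Suc 0) UNIV (u h)"
    using orbit_map_derivative[OF assms(3,1) U0(1) ch U0(2)] by blast
  have cont: "continuous_on UNIV (u h)" for h
  proof -
    obtain u' where "\<forall>x. (u h has_derivative u' x) (at x)"
      using C1[of h] by auto
    then show ?thesis
      by (auto intro!: continuous_at_imp_continuous_on has_derivative_continuous)
  qed
  have lin: "linear (\<lambda>h. u h x)" for x
    using u has_derivative_linear by blast
  have "subspace (range (\<lambda>h. u h xb))"
    using lin[of xb] linear_subspace_image subspace_UNIV by blast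
  then obtain B where B: "B \<subseteq> range (\<lambda>h. u h xb)" "pairwise orthogonal B"
      "\<And>b. b \<in> B \<Longrightarrow> norm b = 1" "independent B" and span_B: "span B = range (\<lambda>h. u h xb)"
    using orthonormal_basis_subspace by metis
  have fin: "finite B"
    using B independent_imp_finite by blast
  have "\<forall>b\<in>B. \<exists>h. u h xb = b"
    using B(1) by blast
  then obtain h where h: "\<And>b. b \<in> B \<Longrightarrow> u (h b) xb = b"
    by metis
  have "\<exists>L\<ge>0. \<forall>x\<in>cball xb 1. \<forall>y\<in>cball xb 1. norm (u (h b) x - u (h b) y) \<le> L * norm (x - y)" for b
    using Cn_on_1_locally_lipschitz[OF C1[of "h b"], of xb] by metis
  then obtain L where L0: "\<And>b. L b \<ge> 0" and L: "\<And>b x y. x \<in> cball xb 1 \<Longrightarrow> y \<in> cball xb 1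
      \<Longrightarrow> norm (u (h b) x - u (h b) y) \<le> L b * norm (x - y)"
    by metis
  define M where "M = 1 + (\<Sum>b\<in>B. L b)"
  have M: "M > 0" and LM: "\<And>b. b \<in> B \<Longrightarrow> L b \<le> M"
    using L0 member_le_sum[OF _ _ fin, of _ L] by (auto simp: M_def sum_nonneg add_pos_nonneg add_increasing)
  have lip: "norm (u (h b) x - u (h b) y) \<le> M * norm (x - y)"
    if "b \<in> B" "x \<in> cball xb 1" "y \<in> cball xb 1" for b x y
    using L[OF that(2,3)] LM[OF that(1)] by (meson mult_right_mono norm_ge_zero order_trans)
  define d where "d = real (card B)"
  have d: "d \<ge> 0"
    by (simp add: d_def)
  define c where "c = 2 * (d + 1) * M"
  have c: "c > 0"
    using M d by (simp add: c_def)
  \<comment> \<open>Inside this radius, the vectors \<open>u (h b) x\<close> differ from the orthonormal \<open>b\<close> by at most \<open>1 / (2 (d + 1))\<close>.\<close>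
  define \<rho> where "\<rho> = min 1 (1 / c)"
  have \<rho>: "0 < \<rho>" "\<rho> \<le> 1"
    using c by (auto simp: \<rho>_def)
  have M\<rho>: "d * (M * \<rho>) \<le> 1 / 2"
  proof -
    have "d * (M * \<rho>) \<le> (d + 1) * (M * \<rho>)"
      using M \<rho> by (intro mult_right_mono) auto
    also have "\<dots> = c * \<rho> / 2"
      by (simp add: c_def)
    also have "c * \<rho> \<le> c * (1 / c)"
      using c by (intro mult_left_mono) (auto simp: \<rho>_def)
    finally show ?thesis
      using c by simp
  qed
  have "norm (orth_proj (orbit_tangent G A \<theta> x) v) \<le> c * norm (x - y) * norm v"
    if x: "x \<in> orbit G \<theta> xb \<inter> ball xb \<rho>" and y: "y \<in> ball xb \<rho>" and v: "v \<in> subdiff f y" for x y v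
  proof -
    have xy: "x \<in> cball xb 1" "y \<in> cball xb 1" "xb \<in> cball xb 1"
      using x y \<rho> by (auto simp: dist_commute)
    define ux where "ux = (\<lambda>b. u (h b) x)"
    have near: "norm (ux b - b) \<le> M * \<rho>" if "b \<in> B" for b
    proof -
      have "norm (ux b - b) \<le> M * norm (x - xb)"
        using lip[OF that xy(1,3)] h[OF that] by (simp add: ux_def)
      also have "\<dots> \<le> M * \<rho>"
        using x M by (intro mult_left_mono) (auto simp: dist_norm norm_minus_commute)
      finally show ?thesis .
    qed
    have M\<rho>': "real (card B) * (M * \<rho>) \<le> 1 / 2"
      using M\<rho> by (simp add: d_def)
    note indep = near_orthonormal_inj_independent[OF fin B(2,3) near M\<rho>']
    obtain g where g: "g \<in> carrier G" "x = \<theta> g xb"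
      using x by (auto simp: orbit_def)
    obtain \<Theta> where \<Theta>: "linear \<Theta>" "orbit_tangent G A \<theta> x \<subseteq> \<Theta> ` span B"
      using orbit_tangent_translate[OF assms(2,3) k1 U0 u g(1)] unfolding g(2) span_B by blast
    have tangent: "orbit_tangent G A \<theta> x = span (ux ` B)"
    proof (rule span_eq_if_dim_le)
      have "span (ux ` B) \<subseteq> range (\<lambda>h. u h x)"
        by (rule span_minimal)
          (use linear_subspace_image[OF lin[of x] subspace_UNIV] in \<open>auto simp: ux_def\<close>)
      also have "\<dots> \<subseteq> orbit_tangent G A \<theta> x"
        unfolding orbit_tangent_def differential_image_def
        by (intro image_subsetI CollectI)
          (rule exI[of _ U0], rule exI[of _ \<phi>], rule exI[of _ "\<lambda>h. u h x"], use U0 u[of x] in auto)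
      finally show "span (ux ` B) \<subseteq> orbit_tangent G A \<theta> x" .
      show "orbit_tangent G A \<theta> x \<subseteq> \<Theta> ` span B" "independent (ux ` B)"
        using \<Theta> indep by auto
      show "subspace (\<Theta> ` span B)"
        using \<Theta> linear_subspace_image subspace_span by blast
      have "dim (\<Theta> ` span B) \<le> dim (span B)"
        by (rule dim_image_le[OF \<Theta>(1)])
      then show "dim (\<Theta> ` span B) \<le> card (ux ` B)"
        using B(4) indep(1) by (simp add: card_image dim_eq_card_independent)
    qed
    define w where "w = orth_proj (orbit_tangent G A \<theta> x) v"
    have w: "w \<in> span (ux ` B)" "(v - w) \<bullet> w = 0"
      using orth_proj_span(1)[of "ux ` B" v] orth_proj_span(2)[of w "ux ` B" v]
      by (auto simp: w_def tangent orthogonal_def)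
    then obtain a' where "w = (\<Sum>z\<in>ux ` B. a' z *\<^sub>R z)"
      using span_finite[of "ux ` B"] fin by auto
    then obtain a where a: "w = (\<Sum>b\<in>B. a b *\<^sub>R ux b)"
      using sum.reindex[OF indep(1), of "\<lambda>z. a' z *\<^sub>R z"] by (auto simp: o_def)
    have orth: "v \<bullet> u (h b) y = 0" for b
      by (rule subdiff_orthogonal_orbit[OF assms(3) car assms(5) ch U0(2) u cont v])
    have "norm w * norm w = v \<bullet> w"
      using w(2) by (simp add: inner_diff_left flip: norm_eq_sqrt_inner dot_square_norm power2_eq_square)
    also have "\<dots> = (\<Sum>b\<in>B. a b * (v \<bullet> (ux b - u (h b) y)))"
      by (simp add: a inner_sum_right inner_diff_right orth)
    also have "\<dots> \<le> (\<Sum>b\<in>B. \<bar>a b\<bar> * (norm v * (M * norm (x - y))))"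
    proof (rule sum_mono)
      fix b assume b: "b \<in> B"
      have "\<bar>v \<bullet> (ux b - u (h b) y)\<bar> \<le> norm v * norm (ux b - u (h b) y)"
        by (rule Cauchy_Schwarz_ineq2)
      also have "\<dots> \<le> norm v * (M * norm (x - y))"
        using lip[OF b xy(1,2)] by (intro mult_left_mono) (auto simp: ux_def)
      finally have "\<bar>a b * (v \<bullet> (ux b - u (h b) y))\<bar> \<le> \<bar>a b\<bar> * (norm v * (M * norm (x - y)))"
        unfolding abs_mult by (rule mult_left_mono) simp
      then show "a b * (v \<bullet> (ux b - u (h b) y)) \<le> \<bar>a b\<bar> * (norm v * (M * norm (x - y)))"
        by linarith
    qed
    also have "\<dots> = (\<Sum>b\<in>B. \<bar>a b\<bar>) * (norm v * (M * norm (x - y)))"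
      by (simp add: sum_distrib_right)
    also have "\<dots> \<le> (2 * d * norm w) * (norm v * (M * norm (x - y)))"
      using sum_coeff_le_near_orthonormal[OF fin B(2,3) near M\<rho>', of a] M
      by (intro mult_right_mono) (auto simp: a d_def)
    also have "\<dots> \<le> (2 * (d + 1) * norm w) * (norm v * (M * norm (x - y)))"
      using M d by (intro mult_right_mono) auto
    also have "\<dots> = norm w * (c * norm (x - y) * norm v)"
      by (simp add: c_def)
    finally have "norm w \<le> c * norm (x - y) * norm v"
      using c by (cases "w = 0") auto
    then show ?thesis
      by (simp add: w_def)
  qed
  then show ?thesis
    using \<rho> c by (intro exI[of _ c] conjI exI[of _ "ball xb \<rho>"]) auto
qed

end
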